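(* A center function $f$ is concurrent for every admissible transversal (of every triangle $ABC$) if and only if, up to multiplication by a factor symmetric in $a,b,c$, $$f(a,b,c)=\cos A\,\Phi(\cos^2A)+\sin A\cos A\,\Psi(\cos^2A),$$ where $A$ is the angle opposite the first argument $a$ (in a triangle with side lengths $a,b,c$) and $\Phi,\Psi$ are functions of one variable.
   Context: An admissible transversal of $\triangle ABC$ is a line $\ell$ that passes through no vertex and is parallel to no side; it meets the sidelines $BC,CA,AB$ at $D,E,F$ respectively. A (barycentric) center function is a real function $f(x,y,z)$ of side lengths, homogeneous and symmetric in its last two arguments; for a triangle $P_1P_2P_3$ whose sides opposite $P_1,P_2,P_3$ have lengths $\lambda_1,\lambda_2,\lambda_3$, its $X$-point is the point with homogeneous barycentric coordinates $(f(\lambda_1,\lambda_2,\lambda_3):f(\lambda_2,\lambda_3,\lambda_1):f(\lambda_3,\lambda_1,\lambda_2))$ relative to $P_1P_2P_3$. With $G,H,I$ the $X$-points of triangles $AEF$, $BFD$, $CDE$, the center $X$ (or its center function $f$) is called concurrent for $\ell$ if the lines $AG,BH,CI$ are concurrent (three parallel lines count as concurrent; it is tacitly understood that the points and lines are defined).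
   Formalization: Concurrent lines are required to be pairwise distinct, and in the "only if" direction the lines AG, BH, CI are assumed to be defined for every admissible transversal of every triangle; without these conditions that direction is false. *)

theory Defs
  imports "HOL-Analysis.Analysis"
begin

section \<open>Center functions\<close>

text \<open>Center functions and symmetric factors are total functions of three reals; only their values
  on the side lengths of nondegenerate triangles matter.\<close>

definition triangle_sides :: "real \<Rightarrow> real \<Rightarrow> real \<Rightarrow> bool" where
  "triangle_sides a b c \<longleftrightarrow>
     0 < a \<and> 0 < b \<and> 0 < c \<and> a < b + c \<and> b < c + a \<and> c < a + b"

definition center_function :: "(real \<Rightarrow> real \<Rightarrow> real \<Rightarrow> real) \<Rightarrow> bool" where
  "center_function f \<longleftrightarrow>
     (\<exists>d::real. \<forall>t>0. \<forall>a b c. triangle_sides a b c \<longrightarrow>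
        f (t * a) (t * b) (t * c) = t powr d * f a b c) \<and>
     (\<forall>a b c. triangle_sides a b c \<longrightarrow> f a c b = f a b c)"

text \<open>The angle opposite the side of length \<open>a\<close> in a triangle with side lengths \<open>a, b, c\<close>, by the
  law of cosines.\<close>

definition opposite_angle :: "real \<Rightarrow> real \<Rightarrow> real \<Rightarrow> real" where
  "opposite_angle a b c = arccos ((b\<^sup>2 + c\<^sup>2 - a\<^sup>2) / (2 * b * c))"

definition symmetric_factor :: "(real \<Rightarrow> real \<Rightarrow> real \<Rightarrow> real) \<Rightarrow> bool" where
  "symmetric_factor s \<longleftrightarrow>
     (\<forall>a b c. triangle_sides a b c \<longrightarrow>
        s a b c \<noteq> 0 \<and> s b a c = s a b c \<and> s a c b = s a b c)"

definition has_cosine_form :: "(real \<Rightarrow> real \<Rightarrow> real \<Rightarrow> real) \<Rightarrow> bool" where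
  "has_cosine_form f \<longleftrightarrow>
     (\<exists>s (\<Phi> :: real \<Rightarrow> real) (\<Psi> :: real \<Rightarrow> real). symmetric_factor s \<and>
        (\<forall>a b c. triangle_sides a b c \<longrightarrow>
           (let A = opposite_angle a b c in
            f a b c = s a b c * (cos A * \<Phi> ((cos A)\<^sup>2) + sin A * cos A * \<Psi> ((cos A)\<^sup>2)))))"


section \<open>The X-point and the line joining it to the first vertex\<close>

type_synonym plane = "real ^ 2"

definition bary :: "(real \<Rightarrow> real \<Rightarrow> real \<Rightarrow> real) \<Rightarrow> plane \<Rightarrow> plane \<Rightarrow> plane \<Rightarrow> real \<times> real \<times> real" where
  "bary f P Q R =
     (let a = dist Q R; b = dist R P; c = dist P Q in (f a b c, f b c a, f c a b))"

definition bary_sum :: "(real \<Rightarrow> real \<Rightarrow> real \<Rightarrow> real) \<Rightarrow> plane \<Rightarrow> plane \<Rightarrow> plane \<Rightarrow> real" where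
  "bary_sum f P Q R = (case bary f P Q R of (u, v, w) \<Rightarrow> u + v + w)"

definition bary_vec :: "(real \<Rightarrow> real \<Rightarrow> real \<Rightarrow> real) \<Rightarrow> plane \<Rightarrow> plane \<Rightarrow> plane \<Rightarrow> plane" where
  "bary_vec f P Q R =
     (case bary f P Q R of (u, v, w) \<Rightarrow> u *\<^sub>R P + v *\<^sub>R Q + w *\<^sub>R R)"

text \<open>The X-point of \<open>P Q R\<close>. If the coordinates have sum \<open>0\<close> (and are not all \<open>0\<close>), the X-point is
  instead the point at infinity in the direction \<open>bary_vec f P Q R\<close>.\<close>

definition X_point :: "(real \<Rightarrow> real \<Rightarrow> real \<Rightarrow> real) \<Rightarrow> plane \<Rightarrow> plane \<Rightarrow> plane \<Rightarrow> plane" where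
  "X_point f P Q R = bary_vec f P Q R /\<^sub>R bary_sum f P Q R"

definition X_line :: "(real \<Rightarrow> real \<Rightarrow> real \<Rightarrow> real) \<Rightarrow> plane \<Rightarrow> plane \<Rightarrow> plane \<Rightarrow> plane set" where
  "X_line f P Q R =
     (if bary_sum f P Q R \<noteq> 0 then affine hull {P, X_point f P Q R}
      else range (\<lambda>t. P + t *\<^sub>R bary_vec f P Q R))"

text \<open>The X-point exists (possibly at infinity) and differs from \<open>P\<close>.\<close>

definition X_line_defined :: "(real \<Rightarrow> real \<Rightarrow> real \<Rightarrow> real) \<Rightarrow> plane \<Rightarrow> plane \<Rightarrow> plane \<Rightarrow> bool" where
  "X_line_defined f P Q R \<longleftrightarrow>
     bary f P Q R \<noteq> (0, 0, 0) \<and> (bary_sum f P Q R \<noteq> 0 \<longrightarrow> X_point f P Q R \<noteq> P)"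


section \<open>Admissible transversals and concurrence\<close>

definition admissible_transversal :: "plane \<Rightarrow> plane \<Rightarrow> plane \<Rightarrow> plane set \<Rightarrow> bool" where
  "admissible_transversal A B C l \<longleftrightarrow>
     affine l \<and> aff_dim l = 1 \<and> A \<notin> l \<and> B \<notin> l \<and> C \<notin> l \<and>
     \<not> affine_parallel l (affine hull {B, C}) \<and>
     \<not> affine_parallel l (affine hull {C, A}) \<and>
     \<not> affine_parallel l (affine hull {A, B})"

text \<open>Concurrent lines are pairwise distinct. Without this, center functions whose values at the
  vertices of certain triangles vanish make two of the three lines coincide and are then concurrent
  for a trivial reason.\<close>

definition concurrent_lines :: "plane set \<Rightarrow> plane set \<Rightarrow> plane set \<Rightarrow> bool" where
  "concurrent_lines l m n \<longleftrightarrow>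
     l \<noteq> m \<and> m \<noteq> n \<and> l \<noteq> n \<and>
     (l \<inter> m \<inter> n \<noteq> {} \<or> affine_parallel l m \<and> affine_parallel m n)"

text \<open>\<open>D, E, F\<close> are the points where an admissible transversal \<open>l\<close> of the triangle \<open>A B C\<close> meets
  the sidelines.\<close>

definition transversal_config ::
  "plane \<Rightarrow> plane \<Rightarrow> plane \<Rightarrow> plane set \<Rightarrow> plane \<Rightarrow> plane \<Rightarrow> plane \<Rightarrow> bool" where
  "transversal_config A B C l D E F \<longleftrightarrow>
     \<not> collinear {A, B, C} \<and> admissible_transversal A B C l \<and>
     D \<in> l \<inter> affine hull {B, C} \<and> E \<in> l \<inter> affine hull {C, A} \<and> F \<in> l \<inter> affine hull {A, B}"

text \<open>The lines \<open>AG, BH, CI\<close> are defined.\<close>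

definition lines_defined ::
  "(real \<Rightarrow> real \<Rightarrow> real \<Rightarrow> real) \<Rightarrow> plane \<Rightarrow> plane \<Rightarrow> plane \<Rightarrow> plane \<Rightarrow> plane \<Rightarrow> plane \<Rightarrow> bool" where
  "lines_defined f A B C D E F \<longleftrightarrow>
     X_line_defined f A E F \<and> X_line_defined f B F D \<and> X_line_defined f C D E"

definition concurrent_for ::
  "(real \<Rightarrow> real \<Rightarrow> real \<Rightarrow> real) \<Rightarrow> plane \<Rightarrow> plane \<Rightarrow> plane \<Rightarrow> plane \<Rightarrow> plane \<Rightarrow> plane \<Rightarrow> bool" where
  "concurrent_for f A B C D E F \<longleftrightarrow>
     concurrent_lines (X_line f A E F) (X_line f B F D) (X_line f C D E)"

end

theory Submission
  imports Defs
begin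

text \<open>
  Let \<open>v\<^sub>A\<close> and \<open>w\<^sub>A\<close> be the values of \<open>f\<close> at the vertices \<open>E\<close> and \<open>F\<close> of the triangle \<open>A E F\<close>,
  \<open>v\<^sub>B\<close> and \<open>w\<^sub>B\<close> those at \<open>F\<close> and \<open>D\<close> of \<open>B F D\<close>, and \<open>v\<^sub>C\<close> and \<open>w\<^sub>C\<close> those at \<open>D\<close> and \<open>E\<close> of
  \<open>C D E\<close>. The line \<open>A G\<close> has the direction \<open>v\<^sub>A (E - A) + w\<^sub>A (F - A)\<close>, and similarly for the
  other two. By Ceva's theorem, with the ratios in which \<open>D\<close>, \<open>E\<close>, \<open>F\<close> divide the sides eliminated
  by Menelaus' theorem, the three lines are concurrent if and only if
  \<open>v\<^sub>A v\<^sub>B v\<^sub>C = - w\<^sub>A w\<^sub>B w\<^sub>C\<close> and no two of them coincide (lemma \<open>concurrent_for_iff\<close>).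

  The cosine form says that \<open>f\<close> is a symmetric factor times \<open>G (cos A)\<close> for an odd function \<open>G\<close>.
  At each of \<open>D\<close>, \<open>E\<close>, \<open>F\<close> two of the six values meet, and the corresponding angles are either
  equal or supplementary; so the two values of \<open>G\<close> agree up to a sign. The number of supplementary
  pairs is odd: this is Menelaus' theorem again, together with the order of the points on
  the transversal. Hence the relation holds (lemma \<open>cosine_form_concurrent\<close>).

  Conversely, take the horizontal axis as the transversal and let the sidelines be the lines of
  directions \<open>(u, 1)\<close>, \<open>(v, 1)\<close>, \<open>(w, 1)\<close> through points of the axis. A triangle with one side on the
  axis has its shape determined by the directions of its other two sides, so, up to a
  homogeneity factor, \<open>f\<close> becomes a function \<open>M x y\<close> of two directions, the value of \<open>f\<close> at the
  foot of the line of direction \<open>x\<close>, and the relation becomes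
  \<open>M v w * M w u * M u v = - (M w v * M u w * M v u)\<close>. So \<open>- M x y / M y x\<close> is a multiplicative
  cocycle, hence equal to \<open>g x / g y\<close> for some \<open>g\<close>. Reflection in a vertical line changes the
  sign of both directions and preserves \<open>M\<close>, and in isosceles triangles this shows that \<open>g\<close> is odd.
  For the vertical direction, the relation forces \<open>M 0 y = 0\<close>: the value of \<open>f\<close> at a right angle
  vanishes (lemma \<open>cocycle_solution\<close>). Consequently, in every triangle the values of \<open>f\<close> at the
  vertices are proportional to the values of the odd function \<open>g\<close> at the cotangents of the angles,
  and the factor of proportionality is symmetric.
\<close>

section \<open>Lines in the plane\<close>

text \<open>Twice the signed area of the triangle spanned by two vectors.\<close>

definition det2 :: "plane \<Rightarrow> plane \<Rightarrow> real" where
  "det2 x y = x $ 1 * y $ 2 - x $ 2 * y $ 1"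

text \<open>The line through \<open>P\<close> with the direction \<open>x\<close>; it is a single point if \<open>x = 0\<close>.\<close>

definition pline :: "plane \<Rightarrow> plane \<Rightarrow> plane set" where
  "pline P x = range (\<lambda>t. P + t *\<^sub>R x)"

lemma plane_eq_iff: "(x::plane) = y \<longleftrightarrow> x $ 1 = y $ 1 \<and> x $ 2 = y $ 2"
  by (simp add: vec_eq_iff forall_2)

lemma det2_eq_0_iff:
  assumes "x \<noteq> 0"
  shows "det2 x y = 0 \<longleftrightarrow> (\<exists>c. y = c *\<^sub>R x)"
proof
  assume d: "det2 x y = 0"
  show "\<exists>c. y = c *\<^sub>R x"
  proof (cases "x $ 1 = 0")
    case True
    then have "x $ 2 \<noteq> 0" using assms by (auto simp: plane_eq_iff)
    then have "y = (y $ 2 / x $ 2) *\<^sub>R x"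
      using d True by (simp add: plane_eq_iff det2_def)
    then show ?thesis by blast
  next
    case False
    then have "y = (y $ 1 / x $ 1) *\<^sub>R x"
      using d by (simp add: plane_eq_iff det2_def field_simps)
    then show ?thesis by blast
  qed
qed (auto simp: det2_def)

lemma mem_pline:
  assumes "x \<noteq> 0"
  shows "X \<in> pline P x \<longleftrightarrow> det2 (X - P) x = 0"
proof -
  have "X \<in> pline P x \<longleftrightarrow> (\<exists>t. X - P = t *\<^sub>R x)"
    by (auto simp: pline_def algebra_simps)
  also have "\<dots> \<longleftrightarrow> det2 x (X - P) = 0" using assms by (simp add: det2_eq_0_iff)
  finally show ?thesis by (simp add: det2_def) argo
qed

lemma collinear_iff_det2: "collinear {A, B, C :: plane} \<longleftrightarrow> det2 (B - A) (C - A) = 0"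
proof -
  have "collinear {A, B, C} \<longleftrightarrow> collinear {0, B - A, C - A}"
    using collinear_3[of B A C] by (simp add: insert_commute)
  also have "\<dots> \<longleftrightarrow> det2 (B - A) (C - A) = 0"
  proof (cases "B - A = 0")
    case False
    then show ?thesis
      using det2_eq_0_iff[OF False, of "C - A"] unfolding collinear_lemma
      by (metis scaleR_zero_left)
  qed (simp add: det2_def)
  finally show ?thesis .
qed

lemma affine_parallel_pline_iff:
  assumes "x \<noteq> 0" "y \<noteq> 0"
  shows "affine_parallel (pline P x) (pline Q y) \<longleftrightarrow> det2 x y = 0"
proof
  assume "affine_parallel (pline P x) (pline Q y)"
  then obtain a where a: "pline Q y = (\<lambda>z. a + z) ` pline P x"
    by (auto simp: affine_parallel_def)
  have "P \<in> pline P x" "P + x \<in> pline P x"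
    using assms by (auto simp: mem_pline det2_def)
  then have "a + P \<in> pline Q y" "a + (P + x) \<in> pline Q y" unfolding a by auto
  then show "det2 x y = 0" using assms by (simp add: mem_pline det2_def algebra_simps)
next
  assume "det2 x y = 0"
  then obtain c where c: "y = c *\<^sub>R x" using det2_eq_0_iff assms by blast
  then have "c \<noteq> 0" using assms by auto
  have "pline Q y = (\<lambda>z. (Q - P) + z) ` pline P x"
  proof (intro set_eqI iffI)
    fix X assume X: "X \<in> pline Q y"
    then have "det2 ((X - (Q - P)) - P) y = 0" using assms by (simp add: mem_pline algebra_simps)
    moreover have "det2 ((X - (Q - P)) - P) y = c * det2 ((X - (Q - P)) - P) x"
      by (simp add: c det2_def algebra_simps)
    ultimately have "X - (Q - P) \<in> pline P x"
      using assms \<open>c \<noteq> 0\<close> by (simp add: mem_pline)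
    then show "X \<in> (\<lambda>z. (Q - P) + z) ` pline P x"
      by (intro image_eqI[where x = "X - (Q - P)"]) auto
  next
    fix X assume "X \<in> (\<lambda>z. (Q - P) + z) ` pline P x"
    then obtain Z where Z: "Z \<in> pline P x" "X = (Q - P) + Z" by auto
    have "det2 (X - Q) y = c * det2 (Z - P) x" by (simp add: c Z det2_def algebra_simps)
    then show "X \<in> pline Q y" using assms Z by (simp add: mem_pline)
  qed
  then show "affine_parallel (pline P x) (pline Q y)" unfolding affine_parallel_def by blast
qed

section \<open>Ceva's theorem\<close>

lemma cevian_direction_nonzero:
  assumes "det2 (B - A) (C - A) \<noteq> 0" "(a, b) \<noteq> (0, 0)"
  shows "a *\<^sub>R (B - A) + b *\<^sub>R (C - A) \<noteq> 0"
proof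
  assume 0: "a *\<^sub>R (B - A) + b *\<^sub>R (C - A) = 0"
  have "a * det2 (B - A) (C - A) = det2 (a *\<^sub>R (B - A) + b *\<^sub>R (C - A)) (C - A)"
    by (simp add: det2_def algebra_simps)
  moreover have "b * det2 (B - A) (C - A) = det2 (B - A) (a *\<^sub>R (B - A) + b *\<^sub>R (C - A))"
    by (simp add: det2_def algebra_simps)
  ultimately show False using assms 0 by (auto simp: det2_def)
qed

lemma det2_rotate: "det2 (C - B) (A - B) = det2 (B - A) (C - A)"
  by (simp add: det2_def algebra_simps)

lemma cevians_equal_iff:
  assumes nc: "det2 (B - A) (C - A) \<noteq> 0"
    and nz: "(a2, a3) \<noteq> (0, 0)" "(b3, b1) \<noteq> (0, 0)"
  shows "pline A (a2 *\<^sub>R (B - A) + a3 *\<^sub>R (C - A)) = pline B (b3 *\<^sub>R (C - B) + b1 *\<^sub>R (A - B))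
    \<longleftrightarrow> a3 = 0 \<and> b3 = 0" (is "pline A ?x = pline B ?y \<longleftrightarrow> _")
proof -
  have x: "?x \<noteq> 0" using cevian_direction_nonzero nc nz by blast
  have y: "?y \<noteq> 0"
    by (rule cevian_direction_nonzero) (use nc nz in \<open>simp_all add: det2_rotate\<close>)
  show ?thesis
  proof
    assume eq: "pline A ?x = pline B ?y"
    have "A \<in> pline A ?x" "B \<in> pline B ?y" using x y by (simp_all add: mem_pline det2_def)
    then have "det2 (A - B) ?y = 0" "det2 (B - A) ?x = 0" using eq x y mem_pline by blast+
    moreover have "det2 (A - B) ?y = - b3 * det2 (B - A) (C - A)"
      "det2 (B - A) ?x = a3 * det2 (B - A) (C - A)"
      by (simp_all add: det2_def algebra_simps)
    ultimately show "a3 = 0 \<and> b3 = 0" using nc by simp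
  next
    assume z: "a3 = 0 \<and> b3 = 0"
    then have "a2 \<noteq> 0" "b1 \<noteq> 0" using nz by auto
    show "pline A ?x = pline B ?y"
    proof (rule set_eqI)
      fix X
      have "det2 (X - A) ?x = a2 * det2 (X - A) (B - A)"
        "det2 (X - B) ?y = - b1 * det2 (X - A) (B - A)"
        using z by (simp_all add: det2_def algebra_simps)
      then show "X \<in> pline A ?x \<longleftrightarrow> X \<in> pline B ?y"
        using x y \<open>a2 \<noteq> 0\<close> \<open>b1 \<noteq> 0\<close> by (simp add: mem_pline)
    qed
  qed
qed

text \<open>The three equations say that a point with barycentric coordinates \<open>(x : y : z)\<close>, possibly at
  infinity, lies on three cevians; eliminating the point gives Ceva's relation.\<close>

lemma ceva_algebra:
  fixes x y z :: real
  assumes "(x, y, z) \<noteq> (0, 0, 0)" "a3 * y = a2 * z" "b1 * z = b3 * x" "c2 * x = c1 * y"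
  shows "a3 * b1 * c2 = a2 * b3 * c1"
proof -
  have "(a3 * b1 * c2 - a2 * b3 * c1) * x = 0" "(a3 * b1 * c2 - a2 * b3 * c1) * y = 0"
    "(a3 * b1 * c2 - a2 * b3 * c1) * z = 0"
    using assms(2-4) by algebra+
  then show ?thesis using assms(1) by auto
qed

lemma affine_coordinates_exist:
  assumes nc: "det2 (B - A) (C - A) \<noteq> 0"
  obtains y z where "X - A = y *\<^sub>R (B - A) + z *\<^sub>R (C - A)"
proof
  show "X - A = (det2 (X - A) (C - A) / det2 (B - A) (C - A)) *\<^sub>R (B - A) +
      (det2 (B - A) (X - A) / det2 (B - A) (C - A)) *\<^sub>R (C - A)"
    using nc by (simp add: plane_eq_iff field_simps) (simp add: det2_def algebra_simps)
qed

text \<open>Ceva's theorem, with parallel lines allowed and with vanishing coefficients, where a cevian is a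
  sideline. The last three conditions say that the lines are pairwise distinct.\<close>

lemma concurrent_cevians_iff:
  fixes A B C :: plane
  assumes nc: "det2 (B - A) (C - A) \<noteq> 0"
    and nz: "(a2, a3) \<noteq> (0, 0)" "(b3, b1) \<noteq> (0, 0)" "(c1, c2) \<noteq> (0, 0)"
  shows "concurrent_lines
      (pline A (a2 *\<^sub>R (B - A) + a3 *\<^sub>R (C - A)))
      (pline B (b3 *\<^sub>R (C - B) + b1 *\<^sub>R (A - B)))
      (pline C (c1 *\<^sub>R (A - C) + c2 *\<^sub>R (B - C))) \<longleftrightarrow>
    a3 * b1 * c2 = a2 * b3 * c1 \<and>
    \<not> (a3 = 0 \<and> b3 = 0) \<and> \<not> (b1 = 0 \<and> c1 = 0) \<and> \<not> (c2 = 0 \<and> a2 = 0)"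
    (is "concurrent_lines (pline A ?x) (pline B ?y) (pline C ?z) \<longleftrightarrow> _")
proof -
  let ?d = "det2 (B - A) (C - A)"
  have r: "det2 (C - B) (A - B) = ?d" "det2 (A - C) (B - C) = ?d"
    by (simp_all add: det2_def algebra_simps)
  have x: "?x \<noteq> 0" using cevian_direction_nonzero nc nz by blast
  have y: "?y \<noteq> 0" by (rule cevian_direction_nonzero) (use nc nz r in simp_all)
  have z: "?z \<noteq> 0" by (rule cevian_direction_nonzero) (use nc nz r in simp_all)
  have distinct:
    "pline A ?x = pline B ?y \<longleftrightarrow> a3 = 0 \<and> b3 = 0"
    "pline B ?y = pline C ?z \<longleftrightarrow> b1 = 0 \<and> c1 = 0"
    "pline C ?z = pline A ?x \<longleftrightarrow> c2 = 0 \<and> a2 = 0"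
    by (rule cevians_equal_iff; use nc nz r in simp)+
  have mem: "X \<in> pline A ?x \<longleftrightarrow> a3 * v = a2 * w"
    "X \<in> pline B ?y \<longleftrightarrow> b1 * w = b3 * (1 - v - w)"
    "X \<in> pline C ?z \<longleftrightarrow> c2 * (1 - v - w) = c1 * v"
    if X: "X = A + v *\<^sub>R (B - A) + w *\<^sub>R (C - A)" for X v w
  proof -
    have "det2 (X - A) ?x = (a3 * v - a2 * w) * ?d"
      "det2 (X - B) ?y = (b1 * w - b3 * (1 - v - w)) * ?d"
      "det2 (X - C) ?z = (c2 * (1 - v - w) - c1 * v) * ?d"
      unfolding X by (simp_all add: det2_def algebra_simps)
    then show "X \<in> pline A ?x \<longleftrightarrow> a3 * v = a2 * w"
      "X \<in> pline B ?y \<longleftrightarrow> b1 * w = b3 * (1 - v - w)"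
      "X \<in> pline C ?z \<longleftrightarrow> c2 * (1 - v - w) = c1 * v"
      using nc x y z by (simp_all add: mem_pline)
  qed
  have det: "det2 ?x ?y = (a3 * b1 + a2 * b3 + a3 * b3) * ?d"
    "det2 ?y ?z = (b1 * c2 + b3 * c1 + b1 * c1) * ?d"
    by (simp_all add: det2_def algebra_simps)
  have par: "affine_parallel (pline A ?x) (pline B ?y) \<longleftrightarrow> a3 * b1 + a2 * b3 + a3 * b3 = 0"
    "affine_parallel (pline B ?y) (pline C ?z) \<longleftrightarrow> b1 * c2 + b3 * c1 + b1 * c1 = 0"
    using x y z nc by (simp_all add: affine_parallel_pline_iff det)
  show ?thesis
  proof
    assume conc: "concurrent_lines (pline A ?x) (pline B ?y) (pline C ?z)"
    have "a3 * b1 * c2 = a2 * b3 * c1"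
    proof (cases "pline A ?x \<inter> pline B ?y \<inter> pline C ?z = {}")
      case False
      then obtain X where X: "X \<in> pline A ?x" "X \<in> pline B ?y" "X \<in> pline C ?z" by auto
      obtain v w where "X - A = v *\<^sub>R (B - A) + w *\<^sub>R (C - A)" using affine_coordinates_exist[OF nc] .
      then have vw: "X = A + v *\<^sub>R (B - A) + w *\<^sub>R (C - A)" by (simp add: algebra_simps)
      have "(1 - v - w, v, w) \<noteq> (0, 0, 0)" by auto
      then show ?thesis
        by (rule ceva_algebra) (use X mem[OF vw] in auto)
    next
      case True
      then have p: "a3 * b1 + a2 * b3 + a3 * b3 = 0" "b1 * c2 + b3 * c1 + b1 * c1 = 0"
        using conc par unfolding concurrent_lines_def by auto
      \<comment> \<open>The common point at infinity, given by the direction of the second line.\<close>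
      have "(b1, - b1 - b3, b3) \<noteq> (0, 0, 0)" using nz by auto
      then show ?thesis
        by (rule ceva_algebra) (use p in \<open>simp_all add: algebra_simps\<close>)
    qed
    then show "a3 * b1 * c2 = a2 * b3 * c1 \<and>
      \<not> (a3 = 0 \<and> b3 = 0) \<and> \<not> (b1 = 0 \<and> c1 = 0) \<and> \<not> (c2 = 0 \<and> a2 = 0)"
      using conc distinct unfolding concurrent_lines_def by metis
  next
    assume R: "a3 * b1 * c2 = a2 * b3 * c1 \<and>
      \<not> (a3 = 0 \<and> b3 = 0) \<and> \<not> (b1 = 0 \<and> c1 = 0) \<and> \<not> (c2 = 0 \<and> a2 = 0)"
    \<comment> \<open>The first two lines meet at \<open>(a3 * b1 : a2 * b3 : a3 * b3)\<close>, which is at infinity if the sum is 0.\<close>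
    define s where "s = a3 * b1 + a2 * b3 + a3 * b3"
    have "pline A ?x \<inter> pline B ?y \<inter> pline C ?z \<noteq> {} \<or>
      affine_parallel (pline A ?x) (pline B ?y) \<and> affine_parallel (pline B ?y) (pline C ?z)"
    proof (cases "s = 0")
      case False
      define X where "X = A + (a2 * b3 / s) *\<^sub>R (B - A) + (a3 * b3 / s) *\<^sub>R (C - A)"
      have u: "1 - a2 * b3 / s - a3 * b3 / s = a3 * b1 / s"
        using False by (simp add: field_simps) (simp add: s_def algebra_simps)
      have "X \<in> pline A ?x \<inter> pline B ?y \<inter> pline C ?z"
        using mem[OF X_def] R unfolding u by (simp add: mult_ac)
      then show ?thesis by blast
    next
      case True
      have "a3 \<noteq> 0"
      proof
        assume "a3 = 0"
        then have "a2 * b3 = 0" using True by (simp add: s_def)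
        then show False using R nz \<open>a3 = 0\<close> by auto
      qed
      moreover have "a3 * (b1 * c2 + b3 * c1 + b1 * c1) = 0"
        using R True unfolding s_def by algebra
      ultimately show ?thesis using True unfolding par s_def by simp
    qed
    then show "concurrent_lines (pline A ?x) (pline B ?y) (pline C ?z)"
      using R distinct unfolding concurrent_lines_def by metis
  qed
qed

section \<open>The cevian through the X-point\<close>

text \<open>Whether the X-point is finite or at infinity, its first coordinate is irrelevant for the line
  that joins it to \<open>P\<close>.\<close>

lemma X_line_defined_iff:
  assumes nc: "det2 (Q - P) (R - P) \<noteq> 0"
  shows "X_line_defined f P Q R \<longleftrightarrow>
    (f (dist R P) (dist P Q) (dist Q R), f (dist P Q) (dist Q R) (dist R P)) \<noteq> (0, 0)"
    (is "_ \<longleftrightarrow> (?v, ?w) \<noteq> _")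
  and X_line_eq_pline: "X_line f P Q R =
    pline P (f (dist R P) (dist P Q) (dist Q R) *\<^sub>R (Q - P) +
      f (dist P Q) (dist Q R) (dist R P) *\<^sub>R (R - P))"
    (is "_ = pline P ?d")
proof -
  let ?u = "f (dist Q R) (dist R P) (dist P Q)"
  have b: "bary f P Q R = (?u, ?v, ?w)" by (simp add: bary_def Let_def)
  have s: "bary_sum f P Q R = ?u + ?v + ?w" by (simp add: bary_sum_def b)
  have vec: "bary_vec f P Q R = (?u + ?v + ?w) *\<^sub>R P + ?d"
    by (simp add: bary_vec_def b algebra_simps)
  have X: "X_point f P Q R - P = inverse (?u + ?v + ?w) *\<^sub>R ?d" if "?u + ?v + ?w \<noteq> 0"
    using that unfolding X_point_def vec s scaleR_add_right by simp
  have d: "?d \<noteq> 0 \<longleftrightarrow> (?v, ?w) \<noteq> (0, 0)"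
    using cevian_direction_nonzero[OF nc] by auto
  show "X_line_defined f P Q R \<longleftrightarrow> (?v, ?w) \<noteq> (0, 0)"
  proof (cases "?u + ?v + ?w = 0")
    case True
    then show ?thesis unfolding X_line_defined_def b s by auto
  next
    case False
    have "X_point f P Q R \<noteq> P \<longleftrightarrow> ?d \<noteq> 0" using X[OF False] False by auto
    then show ?thesis unfolding X_line_defined_def b s d using False by auto
  qed
  show "X_line f P Q R = pline P ?d"
  proof (cases "?u + ?v + ?w = 0")
    case True
    then show ?thesis unfolding X_line_def s vec pline_def by simp
  next
    case False
    have "X_line f P Q R = pline P (inverse (?u + ?v + ?w) *\<^sub>R ?d)"
      unfolding X_line_def s pline_def X[OF False, symmetric] using False
      by (simp add: affine_hull_2_alt)
    also have "\<dots> = pline P ?d"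
    proof (cases "?d = 0")
      case False
      note d0 = this
      show ?thesis
        using \<open>?u + ?v + ?w \<noteq> 0\<close> d0
        by (intro set_eqI) (simp add: mem_pline det2_def right_diff_distrib[symmetric] mult.left_commute del: scaleR_add_right)
    qed simp
    finally show ?thesis .
  qed
qed

section \<open>Ceva's relation for a transversal\<close>

text \<open>The product relation is Menelaus' theorem.\<close>

lemma transversal_parameters:
  assumes cfg: "transversal_config A B C l D E F"
  obtains p q r where
    "D = B + p *\<^sub>R (C - B)" "E = C + q *\<^sub>R (A - C)" "F = A + r *\<^sub>R (B - A)"
    "p \<noteq> 0" "p \<noteq> 1" "q \<noteq> 0" "q \<noteq> 1" "r \<noteq> 0" "r \<noteq> 1"
    "(1 - p) * (1 - q) * (1 - r) = - (p * q * r)"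
    "det2 (B - A) (C - A) \<noteq> 0" "det2 (E - D) (F - D) = 0"
proof -
  have nc: "det2 (B - A) (C - A) \<noteq> 0"
    using cfg by (simp add: transversal_config_def collinear_iff_det2)
  have l: "D \<in> l" "E \<in> l" "F \<in> l" "A \<notin> l" "B \<notin> l" "C \<notin> l" "aff_dim l = 1"
    using cfg by (auto simp: transversal_config_def admissible_transversal_def)
  obtain p where p: "D = B + p *\<^sub>R (C - B)"
    using cfg by (auto simp: transversal_config_def affine_hull_2_alt)
  obtain q where q: "E = C + q *\<^sub>R (A - C)"
    using cfg by (auto simp: transversal_config_def affine_hull_2_alt)
  obtain r where r: "F = A + r *\<^sub>R (B - A)"
    using cfg by (auto simp: transversal_config_def affine_hull_2_alt)
  have "collinear l" using l by (simp add: collinear_aff_dim)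
  then have "collinear {D, E, F}" using l by (auto intro: collinear_subset)
  then have col: "det2 (E - D) (F - D) = 0" by (simp add: collinear_iff_det2)
  have "det2 (E - D) (F - D) =
      ((1 - p) * (1 - q) * (1 - r) + p * q * r) * det2 (B - A) (C - A)"
    unfolding p q r det2_def by (simp add: algebra_simps)
  then have "(1 - p) * (1 - q) * (1 - r) = - (p * q * r)"
    using col nc by simp
  moreover have "p \<noteq> 0" "p \<noteq> 1" "q \<noteq> 0" "q \<noteq> 1" "r \<noteq> 0" "r \<noteq> 1"
    using l p q r by auto
  ultimately show thesis using that p q r nc col by blast
qed

lemma corner_triangles_noncollinear:
  assumes cfg: "transversal_config A B C l D E F"
  shows "det2 (E - A) (F - A) \<noteq> 0" "det2 (F - B) (D - B) \<noteq> 0" "det2 (D - C) (E - C) \<noteq> 0"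
proof -
  obtain p q r where pqr: "D = B + p *\<^sub>R (C - B)" "E = C + q *\<^sub>R (A - C)" "F = A + r *\<^sub>R (B - A)"
    and nz: "p \<noteq> 0" "p \<noteq> 1" "q \<noteq> 0" "q \<noteq> 1" "r \<noteq> 0" "r \<noteq> 1"
    and nc: "det2 (B - A) (C - A) \<noteq> 0"
    using transversal_parameters[OF cfg] by metis
  have "det2 (E - A) (F - A) = - (1 - q) * r * det2 (B - A) (C - A)"
    "det2 (F - B) (D - B) = - (1 - r) * p * det2 (B - A) (C - A)"
    "det2 (D - C) (E - C) = - (1 - p) * q * det2 (B - A) (C - A)"
    unfolding pqr det2_def by (simp_all add: algebra_simps)
  then show "det2 (E - A) (F - A) \<noteq> 0" "det2 (F - B) (D - B) \<noteq> 0" "det2 (D - C) (E - C) \<noteq> 0"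
    using nz nc by auto
qed

lemma concurrent_for_iff:
  assumes cfg: "transversal_config A B C l D E F"
    and ld: "lines_defined f A B C D E F"
  defines "vA \<equiv> f (dist F A) (dist A E) (dist E F)" and "wA \<equiv> f (dist A E) (dist E F) (dist F A)"
    and "vB \<equiv> f (dist D B) (dist B F) (dist F D)" and "wB \<equiv> f (dist B F) (dist F D) (dist D B)"
    and "vC \<equiv> f (dist E C) (dist C D) (dist D E)" and "wC \<equiv> f (dist C D) (dist D E) (dist E C)"
  shows "concurrent_for f A B C D E F \<longleftrightarrow>
    vA * vB * vC = - (wA * wB * wC) \<and>
    \<not> (vA = 0 \<and> wB = 0) \<and> \<not> (vB = 0 \<and> wC = 0) \<and> \<not> (vC = 0 \<and> wA = 0)"
proof -
  obtain p q r where pqr: "D = B + p *\<^sub>R (C - B)" "E = C + q *\<^sub>R (A - C)" "F = A + r *\<^sub>R (B - A)"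
    and nz: "p \<noteq> 0" "p \<noteq> 1" "q \<noteq> 0" "q \<noteq> 1" "r \<noteq> 0" "r \<noteq> 1"
    and men: "(1 - p) * (1 - q) * (1 - r) = - (p * q * r)"
    and nc: "det2 (B - A) (C - A) \<noteq> 0"
    using transversal_parameters[OF cfg] by metis
  note t = corner_triangles_noncollinear[OF cfg]
  have nonzero: "(vA, wA) \<noteq> (0, 0)" "(vB, wB) \<noteq> (0, 0)" "(vC, wC) \<noteq> (0, 0)"
    using ld t unfolding lines_defined_def
    by (simp_all add: X_line_defined_iff vA_def wA_def vB_def wB_def vC_def wC_def)
  have E1: "vA *\<^sub>R (E - A) + wA *\<^sub>R (F - A) =
      (wA * r) *\<^sub>R (B - A) + (vA * (1 - q)) *\<^sub>R (C - A)"
    unfolding pqr by (simp add: algebra_simps)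
  have E2: "vB *\<^sub>R (F - B) + wB *\<^sub>R (D - B) =
      (wB * p) *\<^sub>R (C - B) + (vB * (1 - r)) *\<^sub>R (A - B)"
    unfolding pqr by (simp add: algebra_simps)
  have E3: "vC *\<^sub>R (D - C) + wC *\<^sub>R (E - C) =
      (wC * q) *\<^sub>R (A - C) + (vC * (1 - p)) *\<^sub>R (B - C)"
    unfolding pqr by (simp add: algebra_simps)
  have "concurrent_for f A B C D E F \<longleftrightarrow> concurrent_lines
      (pline A (vA *\<^sub>R (E - A) + wA *\<^sub>R (F - A)))
      (pline B (vB *\<^sub>R (F - B) + wB *\<^sub>R (D - B)))
      (pline C (vC *\<^sub>R (D - C) + wC *\<^sub>R (E - C)))"
    unfolding concurrent_for_def X_line_eq_pline[OF t(1)] X_line_eq_pline[OF t(2)]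
      X_line_eq_pline[OF t(3)] vA_def wA_def vB_def wB_def vC_def wC_def ..
  also have "\<dots> \<longleftrightarrow>
    (vA * (1 - q)) * (vB * (1 - r)) * (vC * (1 - p)) = (wA * r) * (wB * p) * (wC * q) \<and>
    \<not> (vA * (1 - q) = 0 \<and> wB * p = 0) \<and> \<not> (vB * (1 - r) = 0 \<and> wC * q = 0) \<and>
    \<not> (vC * (1 - p) = 0 \<and> wA * r = 0)"
    unfolding E1 E2 E3
    by (rule concurrent_cevians_iff[OF nc]) (use nonzero nz in auto)
  also have "(vA * (1 - q)) * (vB * (1 - r)) * (vC * (1 - p)) = (wA * r) * (wB * p) * (wC * q) \<longleftrightarrow>
      (vA * vB * vC) * ((1 - p) * (1 - q) * (1 - r)) = (wA * wB * wC) * (p * q * r)"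
    by (simp add: mult_ac)
  also have "\<dots> \<longleftrightarrow> (- (vA * vB * vC) - wA * wB * wC) * (p * q * r) = 0"
    unfolding men by (simp add: algebra_simps)
  also have "\<dots> \<longleftrightarrow> vA * vB * vC = - (wA * wB * wC)"
    using nz by auto
  finally show ?thesis using nz by simp
qed

section \<open>Angles and side lengths\<close>

text \<open>The cosine of the angle between two vectors.\<close>

definition cosv :: "plane \<Rightarrow> plane \<Rightarrow> real" where
  "cosv x y = (x \<bullet> y) / (norm x * norm y)"

lemma cosv_commute: "cosv x y = cosv y x"
  by (simp add: cosv_def inner_commute mult.commute)

lemma cosv_scale: "cosv (a *\<^sub>R x) (b *\<^sub>R y) = sgn a * sgn b * cosv x y"
  by (simp add: cosv_def sgn_real_def abs_if)

lemma triangle_sides_rotate: "triangle_sides a b c \<Longrightarrow> triangle_sides b c a"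
  and triangle_sides_swap: "triangle_sides a b c \<Longrightarrow> triangle_sides a c b"
  by (auto simp: triangle_sides_def)

lemma triangle_sides_dist:
  assumes "det2 (Q - P) (R - P) \<noteq> 0"
  shows "triangle_sides (dist Q R) (dist R P) (dist P Q)"
proof -
  have nc: "\<not> collinear {P, Q, R}" using assms by (simp add: collinear_iff_det2)
  then have ne: "P \<noteq> Q" "Q \<noteq> R" "R \<noteq> P" by (auto simp: insert_commute)
  have "\<not> between (P, R) Q" "\<not> between (P, Q) R" "\<not> between (Q, R) P"
    using nc by (metis between_imp_collinear insert_commute)+
  then have "dist P R \<noteq> dist P Q + dist Q R" "dist P Q \<noteq> dist P R + dist R Q"
    "dist Q R \<noteq> dist Q P + dist P R"
    by (simp_all add: between)
  moreover have "dist P R \<le> dist P Q + dist Q R" "dist P Q \<le> dist P R + dist R Q"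
    "dist Q R \<le> dist Q P + dist P R"
    by (rule dist_triangle)+
  ultimately show ?thesis using ne by (simp add: triangle_sides_def dist_commute)
qed

lemma cosine_of_sides:
  fixes P Q R :: plane
  shows "((dist P Q)\<^sup>2 + (dist Q R)\<^sup>2 - (dist R P)\<^sup>2) / (2 * dist P Q * dist Q R) = cosv (P - Q) (R - Q)"
proof -
  have "(dist P Q)\<^sup>2 + (dist Q R)\<^sup>2 - (dist R P)\<^sup>2 = 2 * ((P - Q) \<bullet> (R - Q))"
    unfolding dist_norm power2_norm_eq_inner
    by (simp add: inner_diff_left inner_diff_right inner_commute)
  then show ?thesis by (simp add: cosv_def dist_norm norm_minus_commute)
qed

text \<open>Four times the area of the triangle with side lengths \<open>a, b, c\<close>, by Heron's formula.\<close>

definition area4 :: "real \<Rightarrow> real \<Rightarrow> real \<Rightarrow> real" where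
  "area4 a b c = sqrt ((a + b + c) * (b + c - a) * (c + a - b) * (a + b - c))"

lemma area4_pos: "triangle_sides a b c \<Longrightarrow> area4 a b c > 0"
  by (auto simp: area4_def triangle_sides_def intro!: mult_pos_pos)

lemma area4_perm: "area4 b c a = area4 a b c" "area4 a c b = area4 a b c"
  by (simp_all add: area4_def algebra_simps)

lemma area4_square:
  assumes "triangle_sides a b c"
  shows "(area4 a b c)\<^sup>2 + (b\<^sup>2 + c\<^sup>2 - a\<^sup>2)\<^sup>2 = (2 * b * c)\<^sup>2"
proof -
  have "(a + b + c) * (b + c - a) * (c + a - b) * (a + b - c) \<ge> 0"
    using assms by (auto simp: triangle_sides_def intro!: mult_nonneg_nonneg)
  then have "(area4 a b c)\<^sup>2 = (a + b + c) * (b + c - a) * (c + a - b) * (a + b - c)"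
    by (simp add: area4_def)
  then show ?thesis by (simp add: power2_eq_square algebra_simps)
qed

lemma cos_opposite_angle:
  assumes t: "triangle_sides a b c"
  shows "cos (opposite_angle a b c) = (b\<^sup>2 + c\<^sup>2 - a\<^sup>2) / (2 * b * c)"
    and "sin (opposite_angle a b c) = sqrt (1 - (cos (opposite_angle a b c))\<^sup>2)"
proof -
  have bc: "0 < 2 * b * c" using t by (simp add: triangle_sides_def)
  have "(b\<^sup>2 + c\<^sup>2 - a\<^sup>2)\<^sup>2 \<le> (2 * b * c)\<^sup>2"
    using area4_square[OF t] by (smt (verit) zero_le_power2)
  then have "\<bar>b\<^sup>2 + c\<^sup>2 - a\<^sup>2\<bar> \<le> 2 * b * c" using bc by (metis abs_le_square_iff abs_of_pos)
  then have r: "\<bar>(b\<^sup>2 + c\<^sup>2 - a\<^sup>2) / (2 * b * c)\<bar> \<le> 1"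
    using bc by (simp only: abs_divide abs_of_pos[OF bc] divide_le_eq_1_pos)
  then show *: "cos (opposite_angle a b c) = (b\<^sup>2 + c\<^sup>2 - a\<^sup>2) / (2 * b * c)"
    unfolding opposite_angle_def by (rule cos_arccos_abs)
  show "sin (opposite_angle a b c) = sqrt (1 - (cos (opposite_angle a b c))\<^sup>2)"
    unfolding * using r unfolding opposite_angle_def by (intro sin_arccos) (simp_all only: abs_le_iff, linarith+)
qed

section \<open>The cosine form implies concurrence\<close>

text \<open>Since \<open>sin A = sqrt (1 - cos\<^sup>2 A)\<close>, both summands of the cosine form are odd functions of
  \<open>cos A\<close>.\<close>

lemma has_cosine_formE:
  assumes "has_cosine_form f"
  obtains s G where "symmetric_factor s" "\<And>x::real. G (- x) = - G x"
    "\<And>a b c. triangle_sides a b c \<Longrightarrow>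
       f a b c = s a b c * G ((b\<^sup>2 + c\<^sup>2 - a\<^sup>2) / (2 * b * c) :: real)"
proof -
  obtain s \<Phi> \<Psi> where s: "symmetric_factor s" and
    f: "\<And>a b c. triangle_sides a b c \<Longrightarrow>
        (let A = opposite_angle a b c in
            f a b c = s a b c * (cos A * \<Phi> ((cos A)\<^sup>2) + sin A * cos A * \<Psi> ((cos A)\<^sup>2)))"
    using assms unfolding has_cosine_form_def by blast
  define G where "G x = x * \<Phi> (x\<^sup>2) + sqrt (1 - x\<^sup>2) * x * \<Psi> (x\<^sup>2)" for x
  show thesis
  proof (rule that[OF s])
    show "G (- x) = - G x" for x by (simp add: G_def)
    show "f a b c = s a b c * G ((b\<^sup>2 + c\<^sup>2 - a\<^sup>2) / (2 * b * c))" if "triangle_sides a b c" for a b c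
      using f[OF that] unfolding Let_def cos_opposite_angle(2)[OF that]
      unfolding cos_opposite_angle(1)[OF that] G_def .
  qed
qed

lemma odd_sgn:
  fixes G :: "real \<Rightarrow> real"
  assumes "\<And>x. G (- x) = - G x" "a \<noteq> 0"
  shows "G (sgn a * x) = sgn a * G x"
  using assms by (cases "a > 0") auto

lemma cosine_form_concurrent:
  assumes form: "has_cosine_form f" and cfg: "transversal_config A B C l D E F"
    and ld: "lines_defined f A B C D E F"
  shows "concurrent_for f A B C D E F"
proof -
  obtain s G where s: "symmetric_factor s" and odd: "\<And>x::real. G (- x) = - G x"
    and f: "\<And>a b c. triangle_sides a b c \<Longrightarrow>
       f a b c = s a b c * G ((b\<^sup>2 + c\<^sup>2 - a\<^sup>2) / (2 * b * c) :: real)"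
    using has_cosine_formE[OF form] by metis
  have vw: "f (dist R P) (dist P Q) (dist Q R) = s (dist Q R) (dist R P) (dist P Q) * G (cosv (P - Q) (R - Q))"
    "f (dist P Q) (dist Q R) (dist R P) = s (dist Q R) (dist R P) (dist P Q) * G (cosv (P - R) (Q - R))"
    if "det2 (Q - P) (R - P) \<noteq> 0" for P Q R
  proof -
    have t: "triangle_sides (dist Q R) (dist R P) (dist P Q)"
      using triangle_sides_dist[OF that] .
    note t2 = triangle_sides_rotate[OF t]
    note t3 = triangle_sides_rotate[OF t2]
    have s2: "s (dist R P) (dist P Q) (dist Q R) = s (dist Q R) (dist R P) (dist P Q)"
      "s (dist P Q) (dist Q R) (dist R P) = s (dist Q R) (dist R P) (dist P Q)"
      using s t t2 t3 unfolding symmetric_factor_def by metis+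
    show "f (dist R P) (dist P Q) (dist Q R) = s (dist Q R) (dist R P) (dist P Q) * G (cosv (P - Q) (R - Q))"
      unfolding f[OF t2] s2 cosine_of_sides ..
    show "f (dist P Q) (dist Q R) (dist R P) = s (dist Q R) (dist R P) (dist P Q) * G (cosv (P - R) (Q - R))"
      unfolding f[OF t3] s2 cosine_of_sides cosv_commute[of "P - R"] ..
  qed
  obtain p q r where pqr: "D = B + p *\<^sub>R (C - B)" "E = C + q *\<^sub>R (A - C)" "F = A + r *\<^sub>R (B - A)"
    and nz: "p \<noteq> 0" "p \<noteq> 1" "q \<noteq> 0" "q \<noteq> 1" "r \<noteq> 0" "r \<noteq> 1"
    and men: "(1 - p) * (1 - q) * (1 - r) = - (p * q * r)"
    and nc: "det2 (B - A) (C - A) \<noteq> 0" and col: "det2 (E - D) (F - D) = 0"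
    using transversal_parameters[OF cfg] .
  note t = corner_triangles_noncollinear[OF cfg]
  have ne: "E \<noteq> F" "D \<noteq> E" "D \<noteq> F" using t by (auto simp: det2_def)
  define n where "n = F - E"
  have "n \<noteq> 0" using ne by (simp add: n_def)
  moreover have "det2 n (D - E) = 0" using col by (simp add: n_def det2_def algebra_simps)
  ultimately obtain \<tau> where \<tau>: "D - E = \<tau> *\<^sub>R n" using det2_eq_0_iff by blast
  have \<tau>0: "\<tau> \<noteq> 0" using \<tau> ne by auto
  have \<tau>1: "\<tau> - 1 \<noteq> 0" using \<tau> ne by (auto simp: n_def)
  \<comment> \<open>The sides of the six angles at \<open>D\<close>, \<open>E\<close>, \<open>F\<close>, in terms of the directions of the four lines.\<close>
  have diffs: "A - E = (1 - q) *\<^sub>R (A - C)" "F - E = 1 *\<^sub>R n"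
    "C - E = (- q) *\<^sub>R (A - C)" "D - E = \<tau> *\<^sub>R n"
    "A - F = (- r) *\<^sub>R (B - A)" "E - F = (- 1) *\<^sub>R n"
    "B - F = (1 - r) *\<^sub>R (B - A)" "D - F = (\<tau> - 1) *\<^sub>R n"
    "B - D = (- p) *\<^sub>R (C - B)" "F - D = (- (\<tau> - 1)) *\<^sub>R n"
    "C - D = (1 - p) *\<^sub>R (C - B)" "E - D = (- \<tau>) *\<^sub>R n"
    using \<tau> by (simp_all add: n_def pqr algebra_simps)
  have Gs: "G (cosv (a *\<^sub>R x) (b *\<^sub>R y)) = sgn a * sgn b * G (cosv x y)" if "a \<noteq> 0" "b \<noteq> 0" for a b x y
    unfolding cosv_scale using odd_sgn[of G "a * b"] odd that by (simp add: sgn_mult)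
  define gD where "gD = G (cosv (C - B) n)"
  define gE where "gE = G (cosv (A - C) n)"
  define gF where "gF = G (cosv (B - A) n)"
  define s1 where "s1 = s (dist E F) (dist F A) (dist A E)"
  define s2 where "s2 = s (dist F D) (dist D B) (dist B F)"
  define s3 where "s3 = s (dist D E) (dist E C) (dist C D)"
  have v: "f (dist F A) (dist A E) (dist E F) = s1 * (sgn (1 - q) * gE)"
    "f (dist A E) (dist E F) (dist F A) = s1 * (sgn r * gF)"
    "f (dist D B) (dist B F) (dist F D) = s2 * (sgn (1 - r) * sgn (\<tau> - 1) * gF)"
    "f (dist B F) (dist F D) (dist D B) = s2 * (sgn p * sgn (\<tau> - 1) * gD)"
    "f (dist E C) (dist C D) (dist D E) = s3 * (- sgn (1 - p) * sgn \<tau> * gD)"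
    "f (dist C D) (dist D E) (dist E C) = s3 * (- sgn q * sgn \<tau> * gE)"
    unfolding vw[OF t(1)] vw[OF t(2)] vw[OF t(3)]
    unfolding diffs s1_def[symmetric] s2_def[symmetric] s3_def[symmetric]
    using nz \<tau>0 \<tau>1 by (simp_all add: Gs gD_def gE_def gF_def sgn_minus del: minus_diff_eq scaleR_minus_left scaleR_minus1_left scaleR_one)
  have sg: "sgn (1 - p) * sgn (1 - q) * sgn (1 - r) = - (sgn p * sgn q * sgn r)"
    using arg_cong[OF men, of sgn] by (simp add: sgn_mult sgn_minus)
  have "(f (dist F A) (dist A E) (dist E F), f (dist A E) (dist E F) (dist F A)) \<noteq> (0, 0)"
    "(f (dist D B) (dist B F) (dist F D), f (dist B F) (dist F D) (dist D B)) \<noteq> (0, 0)"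
    "(f (dist E C) (dist C D) (dist D E), f (dist C D) (dist D E) (dist E C)) \<noteq> (0, 0)"
    using ld t unfolding lines_defined_def by (simp_all add: X_line_defined_iff)
  then have d: "s1 \<noteq> 0" "s2 \<noteq> 0" "s3 \<noteq> 0" "(gE, gF) \<noteq> (0, 0)" "(gF, gD) \<noteq> (0, 0)" "(gD, gE) \<noteq> (0, 0)"
    unfolding v by auto
  show ?thesis
    unfolding concurrent_for_iff[OF cfg ld] v
  proof (intro conjI)
    have "s1 * (sgn (1 - q) * gE) * (s2 * (sgn (1 - r) * sgn (\<tau> - 1) * gF)) * (s3 * (- sgn (1 - p) * sgn \<tau> * gD))
      = - (s1 * s2 * s3 * gD * gE * gF * sgn (\<tau> - 1) * sgn \<tau> * (sgn (1 - p) * sgn (1 - q) * sgn (1 - r)))"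
      by (simp add: mult_ac)
    also have "\<dots> = s1 * s2 * s3 * gD * gE * gF * sgn (\<tau> - 1) * sgn \<tau> * (sgn p * sgn q * sgn r)"
      unfolding sg by simp
    finally show "s1 * (sgn (1 - q) * gE) * (s2 * (sgn (1 - r) * sgn (\<tau> - 1) * gF)) * (s3 * (- sgn (1 - p) * sgn \<tau> * gD))
      = - (s1 * (sgn r * gF) * (s2 * (sgn p * sgn (\<tau> - 1) * gD)) * (s3 * (- sgn q * sgn \<tau> * gE)))"
      by (simp add: mult_ac)
  qed (use d nz \<tau>0 \<tau>1 in \<open>auto simp: sgn_eq_0_iff\<close>)
qed

section \<open>Transversals of lines with given directions\<close>

lemma dist_plane: "dist X Y = sqrt ((X $ 1 - Y $ 1)\<^sup>2 + (X $ 2 - Y $ 2)\<^sup>2)" for X Y :: plane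
  by (simp add: dist_vec_def L2_set_def sum_2 dist_real_def)

text \<open>The value of \<open>f\<close> at the vertex \<open>Q\<close> of a triangle \<open>P Q R\<close> with \<open>Q R\<close> on the horizontal axis and
  \<open>P\<close> at distance 1 from it, where the sides \<open>Q P\<close> and \<open>R P\<close> lie on lines with the directions
  \<open>(x, 1)\<close> and \<open>(y, 1)\<close>. The side lengths do not depend on which of \<open>Q\<close> and \<open>R\<close> is on the left or on
  the side of the axis on which \<open>P\<close> lies.\<close>

definition slope_value :: "(real \<Rightarrow> real \<Rightarrow> real \<Rightarrow> real) \<Rightarrow> real \<Rightarrow> real \<Rightarrow> real" where
  "slope_value f x y = f (sqrt (1 + y\<^sup>2)) (sqrt (1 + x\<^sup>2)) \<bar>x - y\<bar>"

lemma slope_value_minus: "slope_value f (- x) (- y) = slope_value f x y"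
  by (simp add: slope_value_def abs_minus_commute)

lemma triangle_sides_slopes:
  assumes "x \<noteq> y"
  shows "triangle_sides (sqrt (1 + y\<^sup>2)) (sqrt (1 + x\<^sup>2)) \<bar>x - y\<bar>"
proof -
  define P Q R :: plane where "P = vector [0, 0]" and "Q = vector [x, 1]" and "R = vector [y, 1]"
  have "det2 (Q - P) (R - P) \<noteq> 0" using assms by (simp add: det2_def P_def Q_def R_def)
  from triangle_sides_rotate[OF triangle_sides_dist[OF this]]
  show ?thesis by (simp add: dist_plane P_def Q_def R_def add.commute)
qed

lemma slope_triangle_values:
  fixes P Q R :: plane
  assumes hom: "\<And>t a b c. t > 0 \<Longrightarrow> triangle_sides a b c \<Longrightarrow> f (t * a) (t * b) (t * c) = t powr d * f a b c"
    and sym: "\<And>a b c. triangle_sides a b c \<Longrightarrow> f a c b = f a b c"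
    and xy: "x \<noteq> y" and pq: "p \<noteq> q" and t: "t = (q - p) / (x - y)"
    and PQR: "P = vector [p + t * x, t]" "Q = vector [p, 0]" "R = vector [q, 0]"
  obtains k where "k \<noteq> 0"
    "f (dist R P) (dist P Q) (dist Q R) = k * slope_value f x y"
    "f (dist P Q) (dist Q R) (dist R P) = k * slope_value f y x"
proof
  have t0: "\<bar>t\<bar> > 0" using xy pq by (simp add: t)
  have tq: "q - p = t * (x - y)" using xy by (simp add: t)
  have PQ: "dist P Q = \<bar>t\<bar> * sqrt (1 + x\<^sup>2)"
  proof -
    have "dist P Q = sqrt (t\<^sup>2 * (1 + x\<^sup>2))"
      by (simp add: dist_plane PQR algebra_simps power_mult_distrib)
    then show ?thesis by (simp add: real_sqrt_mult)
  qed
  have RP: "dist R P = \<bar>t\<bar> * sqrt (1 + y\<^sup>2)"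
  proof -
    have q: "q - (p + t * x) = - (t * y)" using tq by (simp add: algebra_simps)
    have "dist R P = sqrt ((q - (p + t * x))\<^sup>2 + t\<^sup>2)"
      by (simp add: dist_plane PQR)
    also have "(q - (p + t * x))\<^sup>2 + t\<^sup>2 = t\<^sup>2 * (1 + y\<^sup>2)"
      unfolding q by (simp add: algebra_simps power_mult_distrib)
    finally show ?thesis by (simp add: real_sqrt_mult)
  qed
  have QR: "dist Q R = \<bar>t\<bar> * \<bar>x - y\<bar>"
    using arg_cong[OF tq, of abs] by (simp add: dist_plane PQR abs_mult abs_minus_commute)
  note s = triangle_sides_slopes[OF xy]
  have s': "triangle_sides (sqrt (1 + x\<^sup>2)) (sqrt (1 + y\<^sup>2)) \<bar>x - y\<bar>"
    using triangle_sides_slopes[of y x] xy by (simp add: abs_minus_commute)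
  show "\<bar>t\<bar> powr d \<noteq> 0" using t0 by simp
  show "f (dist R P) (dist P Q) (dist Q R) = \<bar>t\<bar> powr d * slope_value f x y"
    unfolding PQ RP QR slope_value_def using hom[OF t0 s] .
  have "f (dist P Q) (dist Q R) (dist R P) = \<bar>t\<bar> powr d * f (sqrt (1 + x\<^sup>2)) \<bar>x - y\<bar> (sqrt (1 + y\<^sup>2))"
    unfolding PQ RP QR using hom[OF t0 triangle_sides_swap[OF s']] .
  then show "f (dist P Q) (dist Q R) (dist R P) = \<bar>t\<bar> powr d * slope_value f y x"
    unfolding slope_value_def sym[OF s'] by (simp add: abs_minus_commute)
qed

lemma horizontal_line: "affine {X :: plane. X $ 2 = 0}" "aff_dim {X :: plane. X $ 2 = 0} = 1"
proof -
  have *: "{X :: plane. X $ 2 = 0} = {X. axis 2 1 \<bullet> X = 0}" by (simp add: inner_axis')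
  show "affine {X :: plane. X $ 2 = 0}" unfolding * by (rule affine_hyperplane)
  show "aff_dim {X :: plane. X $ 2 = 0} = 1" unfolding * by (subst aff_dim_hyperplane) simp_all
qed

lemma not_parallel_horizontal:
  fixes S :: "plane set"
  assumes "X \<in> S" "X $ 2 = 0" "Y \<in> S" "Y $ 2 \<noteq> 0"
  shows "\<not> affine_parallel {X. X $ 2 = 0} S"
proof
  assume "affine_parallel {X :: plane. X $ 2 = 0} S"
  then obtain a where a: "S = (\<lambda>x. a + x) ` {X. X $ 2 = 0}" unfolding affine_parallel_def by blast
  have "a $ 2 = 0" using assms(1,2) unfolding a by auto
  then show False using assms(3,4) unfolding a by auto
qed

lemma foot_in_affine_hull:
  assumes "s \<noteq> r"
  shows "(vector [d, 0] :: plane) \<in> affine hull {vector [d + s * u, s], vector [d + r * u, r]}"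
proof -
  define c where "c = s / (s - r)"
  have "c * (s - r) = s" using assms by (simp add: c_def)
  moreover have "c * (d + r * u - (d + s * u)) = - (c * (s - r)) * u" "c * (r - s) = - (c * (s - r))"
    by (simp_all add: algebra_simps)
  ultimately have "(vector [d, 0] :: plane) = vector [d + s * u, s] +
      c *\<^sub>R (vector [d + r * u, r] - vector [d + s * u, s])"
    by (simp add: plane_eq_iff)
  then show ?thesis unfolding affine_hull_2_alt by blast
qed

text \<open>The sidelines \<open>B C\<close>, \<open>C A\<close>, \<open>A B\<close> have the directions \<open>(u, 1)\<close>, \<open>(v, 1)\<close>, \<open>(w, 1)\<close> and meet the
  transversal at the abscissas \<open>0\<close>, \<open>1\<close>, \<open>k\<close>. Any \<open>k\<close> other than \<open>0\<close>, \<open>1\<close> for which the three sidelines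
  do not pass through one point would do.\<close>

lemma slope_config_exists:
  fixes u v w :: real
  assumes d: "u \<noteq> v" "v \<noteq> w" "w \<noteq> u"
  obtains k :: real and A B C D E F where "k \<noteq> 0" "k \<noteq> 1"
    "transversal_config A B C {X. X $ 2 = 0} D E F"
    "D = vector [0, 0]" "E = vector [1, 0]" "F = vector [k, 0]"
    "A = vector [1 + (k - 1) / (v - w) * v, (k - 1) / (v - w)]"
    "B = vector [k + (0 - k) / (w - u) * w, (0 - k) / (w - u)]"
    "C = vector [0 + (1 - 0) / (u - v) * u, (1 - 0) / (u - v)]"
proof -
  \<comment> \<open>The sidelines pass through one point exactly if \<open>k * (u - v) = u - w\<close>.\<close>
  obtain k :: real where k: "k \<noteq> 0" "k \<noteq> 1" "k * (u - v) \<noteq> u - w"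
  proof (cases "2 * (u - v) = u - w")
    case True
    then show ?thesis using d by (intro that[of 3]) auto
  next
    case False
    then show ?thesis by (intro that[of 2]) auto
  qed
  define t s r where "t = (k - 1) / (v - w)" and "s = (0 - k) / (w - u)" and "r = (1 - 0) / (u - v)"
  define A B C D E F :: plane where
    A: "A = vector [1 + t * v, t]" and B: "B = vector [k + s * w, s]" and C: "C = vector [0 + r * u, r]"
    and D: "D = vector [0, 0]" and E: "E = vector [1, 0]" and F: "F = vector [k, 0]"
  have nz: "t \<noteq> 0" "s \<noteq> 0" "r \<noteq> 0" using k d by (simp_all add: t_def s_def r_def)
  have on: "t * (v - w) = k - 1" "s * (w - u) = - k" "r * (u - v) = 1"
    using d by (simp_all add: t_def s_def r_def)
  have A': "A = vector [k + t * w, t]" and B': "B = vector [0 + s * u, s]" and C': "C = vector [1 + r * v, r]"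
    using on by (simp_all add: A B C plane_eq_iff algebra_simps)
  have conc: "(k * (u - v) - (u - w)) * x \<noteq> 0" if "x \<noteq> 0" for x
    using that k by simp
  have tr: "t \<noteq> r"
  proof
    assume "t = r"
    have "(k * (u - v) - (u - w)) * t = k * (t * (u - v)) - t * (u - v) - t * (v - w)"
      by (simp add: algebra_simps)
    then show False using on conc[of t] nz \<open>t = r\<close> by simp
  qed
  have ts: "t \<noteq> s"
  proof
    assume "t = s"
    have "(k * (u - v) - (u - w)) * t = - k * (t * (v - w) + t * (w - u)) + t * (w - u)"
      by (simp add: algebra_simps)
    then show False using on conc[of t] nz \<open>t = s\<close> by simp
  qed
  have rs: "r \<noteq> s"
  proof
    assume "r = s"
    have "(k * (u - v) - (u - w)) * r = k * (r * (u - v)) + r * (w - u)"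
      by (simp add: algebra_simps)
    then show False using on conc[of r] nz \<open>r = s\<close> by simp
  qed
  have "det2 (B - A) (C - A) = (s - t) * (r - t) * (w - v)"
  proof -
    have BA: "B - A = (s - t) *\<^sub>R vector [w, 1]" unfolding B A'
      by (simp add: plane_eq_iff algebra_simps)
    have CA: "C - A = (r - t) *\<^sub>R vector [v, 1]" unfolding C' A
      by (simp add: plane_eq_iff algebra_simps)
    show ?thesis unfolding BA CA by (simp add: det2_def algebra_simps)
  qed
  then have nc: "\<not> collinear {A, B, C}" using d ts tr by (simp add: collinear_iff_det2)
  have Dh: "D \<in> affine hull {B, C}"
    unfolding D B' C by (rule foot_in_affine_hull) (use rs in simp)
  have Eh: "E \<in> affine hull {C, A}"
    unfolding E C' A by (rule foot_in_affine_hull) (use tr in simp)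
  have Fh: "F \<in> affine hull {A, B}"
    unfolding F A' B by (rule foot_in_affine_hull) (use ts in simp)
  have "\<not> affine_parallel {X. X $ 2 = 0} (affine hull {B, C})"
    by (rule not_parallel_horizontal[OF Dh _ hull_inc[of B]]) (use nz in \<open>simp_all add: D B\<close>)
  moreover have "\<not> affine_parallel {X. X $ 2 = 0} (affine hull {C, A})"
    by (rule not_parallel_horizontal[OF Eh _ hull_inc[of C]]) (use nz in \<open>simp_all add: E C\<close>)
  moreover have "\<not> affine_parallel {X. X $ 2 = 0} (affine hull {A, B})"
    by (rule not_parallel_horizontal[OF Fh _ hull_inc[of A]]) (use nz in \<open>simp_all add: F A\<close>)
  ultimately have "transversal_config A B C {X. X $ 2 = 0} D E F"
    unfolding transversal_config_def admissible_transversal_def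
    using nc Dh Eh Fh horizontal_line nz by (simp add: A B C D E F)
  then show thesis
    using that[of k A B C D E F] k A B C D E F unfolding t_def s_def r_def by blast
qed

section \<open>Concurrence implies the cosine form\<close>

lemma slope_value_identities:
  assumes cf: "center_function f"
    and ld: "\<forall>A B C l D E F. transversal_config A B C l D E F \<longrightarrow> lines_defined f A B C D E F"
    and co: "\<forall>A B C l D E F. transversal_config A B C l D E F \<longrightarrow> concurrent_for f A B C D E F"
    and d: "u \<noteq> v" "v \<noteq> w" "w \<noteq> u"
  shows "slope_value f v w * slope_value f w u * slope_value f u v =
      - (slope_value f w v * slope_value f u w * slope_value f v u)"
    and "slope_value f v w \<noteq> 0 \<or> slope_value f w v \<noteq> 0"
    and "slope_value f v w \<noteq> 0 \<or> slope_value f u w \<noteq> 0"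
proof -
  obtain \<delta> where hom: "\<And>t a b c. t > 0 \<Longrightarrow> triangle_sides a b c \<Longrightarrow>
      f (t * a) (t * b) (t * c) = t powr \<delta> * f a b c"
    using cf unfolding center_function_def by blast
  have sym: "\<And>a b c. triangle_sides a b c \<Longrightarrow> f a c b = f a b c"
    using cf unfolding center_function_def by blast
  obtain k A B C D E F where k: "k \<noteq> 0" "k \<noteq> 1"
    and cfg: "transversal_config A B C {X. X $ 2 = 0} D E F"
    and D: "D = vector [0, 0]" and E: "E = vector [1, 0]" and F: "F = vector [k, 0]"
    and A: "A = vector [1 + (k - 1) / (v - w) * v, (k - 1) / (v - w)]"
    and B: "B = vector [k + (0 - k) / (w - u) * w, (0 - k) / (w - u)]"
    and C: "C = vector [0 + (1 - 0) / (u - v) * u, (1 - 0) / (u - v)]"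
    using slope_config_exists[OF d] .
  obtain k1 where k1: "k1 \<noteq> 0" "f (dist F A) (dist A E) (dist E F) = k1 * slope_value f v w"
    "f (dist A E) (dist E F) (dist F A) = k1 * slope_value f w v"
    by (rule slope_triangle_values[where f = f, OF hom sym \<open>v \<noteq> w\<close> k(2)[symmetric] refl A E F])
  obtain k2 where k2: "k2 \<noteq> 0" "f (dist D B) (dist B F) (dist F D) = k2 * slope_value f w u"
    "f (dist B F) (dist F D) (dist D B) = k2 * slope_value f u w"
    by (rule slope_triangle_values[where f = f, OF hom sym \<open>w \<noteq> u\<close> k(1) refl B F D])
  obtain k3 where k3: "k3 \<noteq> 0" "f (dist E C) (dist C D) (dist D E) = k3 * slope_value f u v"
    "f (dist C D) (dist D E) (dist E C) = k3 * slope_value f v u"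
    by (rule slope_triangle_values[where f = f, OF hom sym \<open>u \<noteq> v\<close> zero_neq_one refl C D E])
  have l: "lines_defined f A B C D E F" and "concurrent_for f A B C D E F"
    using ld co cfg by blast+
  note c = this(2)[unfolded concurrent_for_iff[OF cfg l] k1 k2 k3]
  have "(k1 * k2 * k3) * (slope_value f v w * slope_value f w u * slope_value f u v) =
      (k1 * k2 * k3) * (- (slope_value f w v * slope_value f u w * slope_value f v u))"
    using c by (simp add: mult_ac)
  then show "slope_value f v w * slope_value f w u * slope_value f u v =
      - (slope_value f w v * slope_value f u w * slope_value f v u)"
    using k1(1) k2(1) k3(1) by (metis mult_cancel_left mult_eq_0_iff)
  show "slope_value f v w \<noteq> 0 \<or> slope_value f u w \<noteq> 0" using c by auto
  have "X_line_defined f A E F" using l by (simp add: lines_defined_def)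
  then show "slope_value f v w \<noteq> 0 \<or> slope_value f w v \<noteq> 0"
    unfolding X_line_defined_iff[OF corner_triangles_noncollinear(1)[OF cfg]] k1 by auto
qed

text \<open>The identities for the values of a center function, solved in terms of one odd function.
  The last two assumptions hold because the three lines are defined and pairwise distinct.\<close>

lemma cocycle_solution:
  fixes M :: "real \<Rightarrow> real \<Rightarrow> real"
  assumes even: "\<And>x y. M (- x) (- y) = M x y"
    and id: "\<And>u v w. u \<noteq> v \<Longrightarrow> v \<noteq> w \<Longrightarrow> w \<noteq> u \<Longrightarrow>
      M v w * M w u * M u v = - (M w v * M u w * M v u)"
    and not_both: "\<And>u v w. u \<noteq> v \<Longrightarrow> v \<noteq> w \<Longrightarrow> w \<noteq> u \<Longrightarrow> M v w \<noteq> 0 \<or> M w v \<noteq> 0"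
    and dist: "\<And>u v w. u \<noteq> v \<Longrightarrow> v \<noteq> w \<Longrightarrow> w \<noteq> u \<Longrightarrow> M v w \<noteq> 0 \<or> M u w \<noteq> 0"
  shows "\<exists>g. g 0 = 0 \<and> (\<forall>x. x \<noteq> 0 \<longrightarrow> g x \<noteq> 0) \<and> (\<forall>x. g (- x) = - g x) \<and>
    (\<forall>x y. x \<noteq> y \<longrightarrow> M x y * g y = - (M y x * g x))"
proof -
  have not_both': "M x y \<noteq> 0 \<or> M y x \<noteq> 0" if "x \<noteq> y" for x y
  proof -
    define u where "u = max x y + 1"
    have "u \<noteq> x" "u \<noteq> y" by (auto simp: u_def max_def)
    then show ?thesis using not_both[of u x y] that by auto
  qed
  \<comment> \<open>Whether \<open>M x y\<close> vanishes depends on \<open>x\<close> only.\<close>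
  have indep: "M v u = 0" if "M v w = 0" "v \<noteq> w" "u \<noteq> v" for u v w
  proof (cases "u = w")
    case False
    then show ?thesis using id[of u v w] dist[of u v w] not_both'[of v w] that by auto
  qed (use that in simp)
  have M0: "M x y \<noteq> 0" if "x \<noteq> 0" "x \<noteq> y" for x y
  proof
    assume "M x y = 0"
    then have "M x (- x) = 0" using indep[of x y "- x"] that by auto
    then show False using not_both'[of x "- x"] even[of x "- x"] that by auto
  qed
  have M0y: "M 0 y = 0" if "y \<noteq> 0" for y
  proof -
    \<comment> \<open>The directions \<open>y\<close>, \<open>0\<close>, \<open>- y\<close>: two of the triangles are mirror images, the third is isosceles.\<close>
    have "M 0 (- y) * M (- y) y * M y 0 = - (M (- y) 0 * M y (- y) * M 0 y)"
      using id[of y 0 "- y"] that by auto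
    moreover have "M 0 (- y) = M 0 y" "M (- y) 0 = M y 0" "M (- y) y = M y (- y)"
      using even[of 0 y] even[of y 0] even[of y "- y"] by auto
    ultimately show ?thesis using M0[of y 0] M0[of y "- y"] that by auto
  qed
  define R where "R x y = - (M x y / M y x)" for x y
  have R_cocycle: "R x y * R y z = R x z" if "x \<noteq> y" "y \<noteq> z" "z \<noteq> x" "x \<noteq> 0" "y \<noteq> 0" "z \<noteq> 0" for x y z
    using id[of x y z] that M0 by (simp add: R_def field_simps)
  have R_inverse: "R x y * R y x = 1" if "x \<noteq> y" "x \<noteq> 0" "y \<noteq> 0" for x y
    using that M0 by (simp add: R_def)
  define g where "g x = (if x = 0 then 0 else if x = 1 then 1 else R x 1)" for x
  have g0: "g x \<noteq> 0" if "x \<noteq> 0" for x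
    using that M0 by (simp add: g_def R_def)
  have gR: "R x y * g y = g x" if "x \<noteq> y" "x \<noteq> 0" "y \<noteq> 0" for x y
    using that R_cocycle[of x y 1] R_inverse[of 1 y] by (auto simp: g_def)
  have odd: "g (- x) = - g x" for x
  proof (cases "x = 0")
    case False
    have "M (- x) x = M x (- x)" using even[of x "- x"] by simp
    then have "R x (- x) = - 1" using M0[of x "- x"] False by (simp add: R_def)
    then show ?thesis using gR[of x "- x"] False by auto
  qed (simp add: g_def)
  show ?thesis
  proof (intro exI[of _ g] conjI allI impI)
    show "g 0 = 0" by (simp add: g_def)
    show "g x \<noteq> 0" if "x \<noteq> 0" for x using g0[OF that] .
    show "g (- x) = - g x" for x using odd .
    show "M x y * g y = - (M y x * g x)" if "x \<noteq> y" for x y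
    proof (cases "x = 0 \<or> y = 0")
      case True
      then show ?thesis using M0y that by (auto simp: g_def)
    next
      case False
      then have "M y x \<noteq> 0" using M0 that by auto
      then show ?thesis using gR[of x y] False that by (simp add: R_def field_simps)
    qed
  qed
qed

text \<open>The cotangent of the angle opposite the side of length \<open>a\<close>.\<close>

definition cotangent :: "real \<Rightarrow> real \<Rightarrow> real \<Rightarrow> real" where
  "cotangent a b c = (b\<^sup>2 + c\<^sup>2 - a\<^sup>2) / area4 a b c"

lemma cotangent_swap: "cotangent a c b = cotangent a b c"
  by (simp add: cotangent_def area4_perm add.commute)

lemma sqrt_cotangent:
  assumes t: "triangle_sides a b c"
  shows "sqrt (1 + (cotangent a b c)\<^sup>2) = 2 * b * c / area4 a b c"
proof -
  have T: "area4 a b c > 0" using area4_pos[OF t] .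
  have "1 + (cotangent a b c)\<^sup>2 = (2 * b * c / area4 a b c)\<^sup>2"
    using T area4_square[OF t] by (simp add: cotangent_def power_divide field_simps)
  then show ?thesis using T t by (simp add: triangle_sides_def)
qed

lemma cotangent_add:
  assumes "triangle_sides a b c"
  shows "cotangent a b c + cotangent b c a = 2 * c * c / area4 a b c"
  using area4_pos[OF assms]
  by (simp add: cotangent_def area4_perm field_simps power2_eq_square)

lemma concurrent_imp_cosine_form:
  assumes cf: "center_function f"
    and ld: "\<forall>A B C l D E F. transversal_config A B C l D E F \<longrightarrow> lines_defined f A B C D E F"
    and co: "\<forall>A B C l D E F. transversal_config A B C l D E F \<longrightarrow> concurrent_for f A B C D E F"
  shows "has_cosine_form f"
proof -
  obtain \<delta> where hom: "\<And>t a b c. t > 0 \<Longrightarrow> triangle_sides a b c \<Longrightarrow>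
      f (t * a) (t * b) (t * c) = t powr \<delta> * f a b c"
    using cf unfolding center_function_def by blast
  have sym: "\<And>a b c. triangle_sides a b c \<Longrightarrow> f a c b = f a b c"
    using cf unfolding center_function_def by blast
  note ids = slope_value_identities[OF cf ld co]
  obtain g where *: "g 0 = 0 \<and> (\<forall>x. x \<noteq> 0 \<longrightarrow> g x \<noteq> 0) \<and> (\<forall>x. g (- x) = - g x) \<and>
      (\<forall>x y. x \<noteq> y \<longrightarrow> slope_value f x y * g y = - (slope_value f y x * g x))"
    using cocycle_solution[of "slope_value f", OF slope_value_minus ids] by (rule exE)
  note g = *[THEN conjunct1] *[THEN conjunct2, THEN conjunct1, rule_format]
    *[THEN conjunct2, THEN conjunct2, THEN conjunct1, rule_format]
  note gM = *[THEN conjunct2, THEN conjunct2, THEN conjunct2, rule_format]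
  define h where "h a b c = g (cotangent a b c)" for a b c
  have h_swap: "h a c b = h a b c" for a b c by (simp add: h_def cotangent_swap)
  have minors: "f a b c * h b c a = f b c a * h a b c" and nonzero: "f a b c \<noteq> 0 \<or> f b c a \<noteq> 0"
    if t: "triangle_sides a b c" for a b c
  proof -
    \<comment> \<open>Placed with the side of length \<open>c\<close> on the axis, the triangle has sides with the directions
      \<open>(?x, 1)\<close> and \<open>(- ?y, 1)\<close>, and \<open>2 * c / area4 a b c\<close> scales its height to 1.\<close>
    let ?x = "cotangent a b c" and ?y = "cotangent b c a"
    define k where "k = 2 * c / area4 a b c"
    have k: "k > 0" using t area4_pos[OF t] by (simp add: k_def triangle_sides_def)
    have t2: "triangle_sides b c a" using triangle_sides_rotate[OF t] .
    have t': "triangle_sides b a c" using triangle_sides_swap[OF t2] .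
    have x: "sqrt (1 + ?x\<^sup>2) = k * b" using sqrt_cotangent[OF t] by (simp add: k_def)
    have y: "sqrt (1 + ?y\<^sup>2) = k * a"
      using sqrt_cotangent[OF t2] by (simp add: k_def area4_perm)
    have z: "?x + ?y = k * c" using cotangent_add[OF t] by (simp add: k_def)
    have c: "c > 0" using t by (simp add: triangle_sides_def)
    have ne: "?x \<noteq> - ?y" using z k c by (metis add.left_inverse less_numeral_extra(3) mult_pos_pos)
    have "k * c > 0" using k c by simp
    then have abs: "\<bar>?x + ?y\<bar> = k * c" "\<bar>- ?y - ?x\<bar> = k * c" using z by linarith+
    have 1: "slope_value f ?x (- ?y) = k powr \<delta> * f a b c"
      using hom[OF k t] abs x y by (simp add: slope_value_def)
    have 2: "slope_value f (- ?y) ?x = k powr \<delta> * f b c a"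
      using hom[OF k t'] sym[OF t2] abs x y by (simp add: slope_value_def)
    have "k powr \<delta> * (f a b c * h b c a) = k powr \<delta> * (f b c a * h a b c)"
      using gM[OF ne] unfolding 1 2 h_def g(3) by (simp add: mult_ac)
    then show "f a b c * h b c a = f b c a * h a b c" using k by simp
    obtain u where "u \<noteq> ?x" "u \<noteq> - ?y"
      by (metis less_irrefl max.strict_boundedE lt_ex gt_ex)
    then show "f a b c \<noteq> 0 \<or> f b c a \<noteq> 0" using ids(2)[of u ?x "- ?y"] ne unfolding 1 2 by auto
  qed
  \<comment> \<open>The triples of values of \<open>f\<close> and of \<open>h\<close> are proportional; their scalar product gives a formula for
    the factor that has no vanishing denominator, although one value of \<open>h\<close> may be 0.\<close>
  define N where "N a b c = (h a b c)\<^sup>2 + (h b c a)\<^sup>2 + (h c a b)\<^sup>2" for a b c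
  define s where "s a b c = (f a b c * h a b c + f b c a * h b c a + f c a b * h c a b) / N a b c" for a b c
  have N0: "N a b c \<noteq> 0" if t: "triangle_sides a b c" for a b c
  proof
    assume "N a b c = 0"
    then have "h a b c = 0" "h b c a = 0" unfolding N_def
      by (smt (verit) zero_le_power2 zero_eq_power2)+
    then have "cotangent a b c = 0" "cotangent b c a = 0" using g(2) unfolding h_def by blast+
    then show False using cotangent_add[OF t] area4_pos[OF t] t by (simp add: triangle_sides_def)
  qed
  have fs: "f a b c = s a b c * h a b c" if t: "triangle_sides a b c" for a b c
  proof -
    note t2 = triangle_sides_rotate[OF t]
    note p = minors[OF t] minors[OF t2] minors[OF triangle_sides_rotate[OF t2]]
    have "f a b c * N a b c = (f a b c * h a b c + f b c a * h b c a + f c a b * h c a b) * h a b c"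
      unfolding N_def using p by algebra
    then show ?thesis using N0[OF t] by (simp add: s_def field_simps)
  qed
  have srot: "s b c a = s a b c" for a b c by (simp add: s_def N_def algebra_simps)
  have s0: "s a b c \<noteq> 0" if t: "triangle_sides a b c" for a b c
  proof
    assume s: "s a b c = 0"
    have t2: "triangle_sides b c a" using triangle_sides_rotate[OF t] .
    have z: "f a b c = 0" "f b c a = 0" using fs[OF t] fs[OF t2] srot s by simp_all
    then show False using nonzero[OF t] by simp
  qed
  have swap: "s a c b = s a b c" if t: "triangle_sides a b c" for a b c
  proof -
    note t2 = triangle_sides_rotate[OF t]
    note t3 = triangle_sides_rotate[OF t2]
    show ?thesis
      unfolding s_def N_def h_swap[of a b c] h_swap[of b c a] h_swap[of c a b] sym[OF t] sym[OF t2] sym[OF t3]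
      by (simp add: add_ac)
  qed
  have "symmetric_factor s"
    unfolding symmetric_factor_def
    using s0 swap srot triangle_sides_rotate by metis
  \<comment> \<open>The cotangent is \<open>cos A / sqrt (1 - cos\<^sup>2 A)\<close>, and \<open>g\<close> is odd; at \<open>t = 0\<close> the value 0 is harmless, as
    \<open>\<Phi> t\<close> is multiplied by \<open>cos A = 0\<close> and \<open>g 0 = 0\<close>.\<close>
  define \<Phi> where "\<Phi> t = g (sqrt t / sqrt (1 - t)) / sqrt t" for t
  have h\<Phi>: "h a b c = cos A * \<Phi> ((cos A)\<^sup>2)" if t: "triangle_sides a b c" and A: "A = opposite_angle a b c" for a b c A
  proof -
    have bc: "0 < 2 * b * c" using t by (simp add: triangle_sides_def)
    have T: "area4 a b c > 0" using area4_pos[OF t] .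
    have c: "cos A = (b\<^sup>2 + c\<^sup>2 - a\<^sup>2) / (2 * b * c)" using cos_opposite_angle[OF t] A by simp
    have area: "(area4 a b c)\<^sup>2 = (2 * b * c)\<^sup>2 - (b\<^sup>2 + c\<^sup>2 - a\<^sup>2)\<^sup>2"
      using area4_square[OF t] by simp
    have square: "1 - (x / m)\<^sup>2 = (m\<^sup>2 - x\<^sup>2) / m\<^sup>2" if "m \<noteq> 0" for x m :: real
      using that by (simp add: power_divide diff_divide_distrib)
    have nonzero: "2 * b * c \<noteq> 0" using bc by linarith
    from square[OF this] have "1 - (cos A)\<^sup>2 = (area4 a b c / (2 * b * c))\<^sup>2"
      unfolding c power_divide[of "area4 a b c"] area .
    then have q: "sqrt (1 - (cos A)\<^sup>2) = area4 a b c / (2 * b * c)" using T bc by simp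
    have cancel: "x / y = (x / m) / (y / m)" if "m \<noteq> 0" for x y m :: real
      using that by simp
    have "cotangent a b c = cos A / sqrt (1 - (cos A)\<^sup>2)"
      unfolding q unfolding c cotangent_def by (rule cancel[OF nonzero])
    then have h: "h a b c = g (cos A / sqrt (1 - (cos A)\<^sup>2))" by (simp add: h_def)
    show ?thesis
    proof (cases "cos A \<ge> 0")
      case True
      then show ?thesis unfolding h \<Phi>_def using g(1) by simp
    next
      case False
      then show ?thesis unfolding h \<Phi>_def using g(3) by simp
    qed
  qed
  show ?thesis
    unfolding has_cosine_form_def Let_def
    using \<open>symmetric_factor s\<close> fs h\<Phi> by (intro exI[of _ s] exI[of _ \<Phi>] exI[of _ "\<lambda>_. 0"]) simp
qed

theorem theorem7p4:
  fixes f :: "real \<Rightarrow> real \<Rightarrow> real \<Rightarrow> real"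
  assumes "center_function f"
  shows "((\<forall>A B C l D E F. transversal_config A B C l D E F \<longrightarrow> lines_defined f A B C D E F) \<longrightarrow>
            ((\<forall>A B C l D E F. transversal_config A B C l D E F \<longrightarrow> concurrent_for f A B C D E F)
              \<longleftrightarrow> has_cosine_form f)) \<and>
         (has_cosine_form f \<longrightarrow>
            (\<forall>A B C l D E F. transversal_config A B C l D E F \<longrightarrow> lines_defined f A B C D E F \<longrightarrow>
               concurrent_for f A B C D E F))"
  using concurrent_imp_cosine_form[OF assms] cosine_form_concurrent by blast

end
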